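(* Let $\mathfrak g$ be a simple complete left-symmetric algebra over $\mathbb C$ whose canonical decomposition $\mathfrak g=\bigoplus_\lambda\mathfrak g^\lambda$ satisfies $\dim\mathfrak g^\lambda\le 1$ for all $\lambda$. Then $\Gamma_l$ and $\Gamma_r$ contain at least one pair of symmetric vertices $\lambda,-\lambda$ and edges from them to $0$; that is, there exists $\lambda\ne0$ with $\lambda,-\lambda\in\Lambda$ such that each of $\Gamma_l$ and $\Gamma_r$ contains an edge from $\lambda$ to $0$ and an edge from $-\lambda$ to $0$.
   Context: All algebras are finite dimensional. A left-symmetric algebra is a vector space $\mathfrak g$ with a bilinear product such that $x(yz)-(xy)z=y(xz)-(yx)z$ for all $x,y,z$. Then $[x,y]=xy-yx$ is a Lie bracket and $L(x)y=xy$ defines a representation of the Lie algebra $\mathfrak g$. The fields $F_x(y)=xy+x$, $x\in\mathfrak g$, form a Lie algebra of affine vector fields on the space $\mathfrak g$; $\mathfrak g$ is complete if the group of affine transformations generated by their flows acts transitively on $\mathfrak g$. A subspace $\mathfrak j\subseteq\mathfrak g$ is an ideal if $\mathfrak j\mathfrak g\subseteq\mathfrak j$ and $\mathfrak g\mathfrak j\subseteq\mathfrak j$ (a two-sided ideal); $\mathfrak g$ is simple if it contains no proper ideals. Canonical decomposition: a complete left-symmetric algebra over $\mathbb C$ has a unique Cartan subalgebra $\mathfrak h$ of the Lie algebra $\mathfrak g$ such that, for every linear functional $\lambda$ on $\mathfrak h$, the root subspace (generalized weight space) $\mathfrak g^\lambda$ of $\lambda$ for $L|_{\mathfrak h}$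 equals the root subspace for $\operatorname{ad}|_{\mathfrak h}$, where $\operatorname{ad}(x)y=[x,y]$; the canonical decomposition is $\mathfrak g=\bigoplus_\lambda\mathfrak g^\lambda$, and $\mathfrak g^0=\mathfrak h$. It satisfies $\mathfrak g^\lambda\mathfrak g^\mu\subseteq\mathfrak g^{\lambda+\mu}$. Graphs: assume $\dim\mathfrak g^\lambda\le1$ for all $\lambda$. Fix $e_0\in\mathfrak g^0$, $e_0\neq0$. Identify each functional $\lambda$ with $\mathfrak g^\lambda\ne0$ with the number $\lambda(e_0)$; the set of these numbers is $\Lambda\subset\mathbb C$, the spectrum of $L(e_0)$ (it contains $0$). For each $\lambda\in\Lambda$ choose an eigenvector $e_\lambda\in\mathfrak g^\lambda$, $e_0e_\lambda=\lambda e_\lambda$ (with the chosen $e_0$ for $\lambda=0$). In the base $\{e_\lambda\}_{\lambda\in\Lambda}$ the product is $e_\lambda e_\mu=c_{\lambda,\mu}e_{\lambda+\mu}$, with the convention $e_\lambda=0$ and $c_{\lambda,\mu}=c_{\mu,\lambda}=0$ if $\lambda\notin\Lambda$. $\Gamma_l$ and $\Gamma_r$ are the directed graphs (loops allowed) with vertex set $\Lambda$: $\Gamma_l$ has an edge from $\lambda$ to $\mu$ if and only if $c_{\mu-\lambda,\lambda}\neq0$; $\Gamma_r$ has an edge from $\lambda$ to $\mu$ if and only if $c_{\lambda,\mu-\lambda}\neq0$.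
   Formalization: "Simple" is taken to include that the product is not identically zero; without this the claim fails for the one-dimensional algebra ℂ with zero product, where Λ = {0}, and this is the only algebra excluded. *)

theory Defs
  imports
    "HOL-Analysis.Analysis"
    "HOL-Algebra.Bij"
    "HOL-Algebra.Generated_Groups"
    "Graph_Theory.Pair_Digraph"
begin

text \<open>A finite-dimensional complex vector space is modelled as \<open>complex ^ 'n\<close> with the complex
  scaling \<open>(*s)\<close>; \<open>vec.subspace\<close>, \<open>vec.span\<close> and \<open>vec.dim\<close> are therefore notions over the complex
  numbers. A product is a map \<open>m\<close> with \<open>m x y\<close> standing for \<open>xy\<close>.\<close>

type_synonym 'n product = "complex ^ 'n \<Rightarrow> complex ^ 'n \<Rightarrow> complex ^ 'n"

definition bilinear_product :: "'n::finite product \<Rightarrow> bool" where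
  "bilinear_product m \<longleftrightarrow>
     (\<forall>x. Vector_Spaces.linear (*s) (*s) (\<lambda>y. m x y)) \<and>
     (\<forall>y. Vector_Spaces.linear (*s) (*s) (\<lambda>x. m x y))"

definition left_symmetric_algebra :: "'n::finite product \<Rightarrow> bool" where
  "left_symmetric_algebra m \<longleftrightarrow>
     bilinear_product m \<and>
     (\<forall>x y z. m x (m y z) - m (m x y) z = m y (m x z) - m (m y x) z)"

definition lie_bracket :: "'n::finite product \<Rightarrow> 'n product" where
  "lie_bracket m x y = m x y - m y x"


subsection \<open>Completeness\<close>

definition affine_field :: "'n::finite product \<Rightarrow> complex ^ 'n \<Rightarrow> complex ^ 'n \<Rightarrow> complex ^ 'n" where
  "affine_field m x y = m x y + x"

definition is_flow :: "(complex ^ 'n \<Rightarrow> complex ^ 'n) \<Rightarrow>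
    (real \<Rightarrow> complex ^ 'n \<Rightarrow> complex ^ 'n::finite) \<Rightarrow> bool" where
  "is_flow F \<phi> \<longleftrightarrow>
     (\<forall>y. \<phi> 0 y = y) \<and>
     (\<forall>y t. ((\<lambda>s. \<phi> s y) has_vector_derivative F (\<phi> t y)) (at t))"

text \<open>Real time suffices: \<open>affine_field m (a *s x) y = a *s affine_field m x y\<close>, so the flow of
  the field of \<open>x\<close> at a complex time \<open>a\<close> is the flow of the field of \<open>a *s x\<close> at time 1.\<close>

definition affine_flow_group :: "'n::finite product \<Rightarrow> (complex ^ 'n \<Rightarrow> complex ^ 'n) set" where
  "affine_flow_group m =
     generate (BijGroup UNIV) {\<phi> t | \<phi> t x. is_flow (affine_field m x) \<phi>}"

definition complete_lsa :: "'n::finite product \<Rightarrow> bool" where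
  "complete_lsa m \<longleftrightarrow> (\<forall>y z. \<exists>g\<in>affine_flow_group m. g y = z)"


subsection \<open>Simplicity\<close>

definition two_sided_ideal :: "'n::finite product \<Rightarrow> (complex ^ 'n) set \<Rightarrow> bool" where
  "two_sided_ideal m J \<longleftrightarrow> vec.subspace J \<and> (\<forall>x\<in>J. \<forall>y. m x y \<in> J \<and> m y x \<in> J)"

text \<open>As usual, an algebra with zero product does not count as simple; for complete left-symmetric
  algebras this only excludes the one-dimensional one.\<close>

definition simple_algebra :: "'n::finite product \<Rightarrow> bool" where
  "simple_algebra m \<longleftrightarrow>
     (\<exists>x y. m x y \<noteq> 0) \<and> (\<forall>J. two_sided_ideal m J \<longrightarrow> J = {0} \<or> J = UNIV)"


subsection \<open>Cartan subalgebras and the canonical decomposition\<close>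

text \<open>In this subsection \<open>b\<close> is a Lie bracket.\<close>

definition lie_subalgebra :: "'n::finite product \<Rightarrow> (complex ^ 'n) set \<Rightarrow> bool" where
  "lie_subalgebra b H \<longleftrightarrow> vec.subspace H \<and> (\<forall>x\<in>H. \<forall>y\<in>H. b x y \<in> H)"

fun lower_central :: "'n::finite product \<Rightarrow> (complex ^ 'n) set \<Rightarrow> nat \<Rightarrow> (complex ^ 'n) set" where
  "lower_central b H 0 = H"
| "lower_central b H (Suc k) = vec.span {b x y | x y. x \<in> H \<and> y \<in> lower_central b H k}"

definition cartan_subalgebra :: "'n::finite product \<Rightarrow> (complex ^ 'n) set \<Rightarrow> bool" where
  "cartan_subalgebra b H \<longleftrightarrow>
     lie_subalgebra b H \<and>
     (\<exists>k. lower_central b H k = {0}) \<and>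
     {x. \<forall>y\<in>H. b x y \<in> H} = H"

definition functional_on :: "(complex ^ 'n::finite) set \<Rightarrow> (complex ^ 'n \<Rightarrow> complex) \<Rightarrow> bool" where
  "functional_on H l \<longleftrightarrow>
     (\<forall>x\<in>H. \<forall>y\<in>H. l (x + y) = l x + l y) \<and> (\<forall>a. \<forall>x\<in>H. l (a *s x) = a * l x)"

definition root_space :: "'n::finite product \<Rightarrow> (complex ^ 'n) set \<Rightarrow>
    (complex ^ 'n \<Rightarrow> complex) \<Rightarrow> (complex ^ 'n) set" where
  "root_space \<rho> H l = {v. \<forall>x\<in>H. \<exists>k. ((\<lambda>w. \<rho> x w - l x *s w) ^^ k) v = 0}"

definition canonical_cartan :: "'n::finite product \<Rightarrow> (complex ^ 'n) set \<Rightarrow> bool" where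
  "canonical_cartan m H \<longleftrightarrow>
     cartan_subalgebra (lie_bracket m) H \<and>
     (\<forall>l. functional_on H l \<longrightarrow> root_space m H l = root_space (lie_bracket m) H l)"


subsection \<open>The graphs\<close>

definition root_numbers :: "'n::finite product \<Rightarrow> (complex ^ 'n) set \<Rightarrow> complex ^ 'n \<Rightarrow> complex set" where
  "root_numbers m H e0 = {l e0 | l. functional_on H l \<and> root_space m H l \<noteq> {0}}"

definition root_base :: "'n::finite product \<Rightarrow> (complex ^ 'n) set \<Rightarrow> complex ^ 'n \<Rightarrow>
    (complex \<Rightarrow> complex ^ 'n) \<Rightarrow> bool" where
  "root_base m H e0 e \<longleftrightarrow>
     e 0 = e0 \<and>
     (\<forall>l. functional_on H l \<and> root_space m H l \<noteq> {0} \<longrightarrow>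
        e (l e0) \<in> root_space m H l \<and> e (l e0) \<noteq> 0 \<and> m e0 (e (l e0)) = l e0 *s e (l e0)) \<and>
     (\<forall>\<alpha>. \<alpha> \<notin> root_numbers m H e0 \<longrightarrow> e \<alpha> = 0)"

text \<open>The value of \<open>c \<alpha> \<beta>\<close> is unconstrained if \<open>\<alpha>\<close>, \<open>\<beta>\<close> are in \<open>\<Lambda>\<close> but \<open>\<alpha> + \<beta>\<close> is not; such
  values do not enter the graphs.\<close>

definition structure_constants :: "'n::finite product \<Rightarrow> complex set \<Rightarrow>
    (complex \<Rightarrow> complex ^ 'n) \<Rightarrow> (complex \<Rightarrow> complex \<Rightarrow> complex) \<Rightarrow> bool" where
  "structure_constants m \<Lambda> e c \<longleftrightarrow>
     (\<forall>\<alpha>\<in>\<Lambda>. \<forall>\<beta>\<in>\<Lambda>. m (e \<alpha>) (e \<beta>) = c \<alpha> \<beta> *s e (\<alpha> + \<beta>)) \<and>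
     (\<forall>\<alpha> \<beta>. \<alpha> \<notin> \<Lambda> \<longrightarrow> c \<alpha> \<beta> = 0 \<and> c \<beta> \<alpha> = 0)"

definition Gamma_l :: "complex set \<Rightarrow> (complex \<Rightarrow> complex \<Rightarrow> complex) \<Rightarrow> complex pair_pre_digraph" where
  "Gamma_l \<Lambda> c = \<lparr> pverts = \<Lambda>, parcs = {(\<alpha>, \<beta>). \<alpha> \<in> \<Lambda> \<and> \<beta> \<in> \<Lambda> \<and> c (\<beta> - \<alpha>) \<alpha> \<noteq> 0} \<rparr>"

definition Gamma_r :: "complex set \<Rightarrow> (complex \<Rightarrow> complex \<Rightarrow> complex) \<Rightarrow> complex pair_pre_digraph" where
  "Gamma_r \<Lambda> c = \<lparr> pverts = \<Lambda>, parcs = {(\<alpha>, \<beta>). \<alpha> \<in> \<Lambda> \<and> \<beta> \<in> \<Lambda> \<and> c \<alpha> (\<beta> - \<alpha>) \<noteq> 0} \<rparr>"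

end

theory Submission
  imports Defs "HOL-Computational_Algebra.Fundamental_Theorem_Algebra"
begin

text \<open>
  Write \<open>e \<alpha>\<close> for the chosen root vectors, so that \<open>e 0 = e0\<close>. In terms of the structure constants,
  the claim is that \<open>c \<alpha> (- \<alpha>)\<close> and \<open>c (- \<alpha>) \<alpha>\<close> are both nonzero for some \<open>\<alpha> \<noteq> 0\<close>.

  As the root space of \<open>0\<close> is a line, the Cartan subalgebra is that line, spanned by \<open>e0\<close>, and
  root spaces are generalized eigenspaces of the single operator \<open>L(e0)\<close>, and equally of \<open>ad(e0)\<close>
  (\<open>root_space_span_singleton\<close>). A root vector in a one-dimensional root space is an eigenvector
  of both, with the same eigenvalue, and comparing \<open>e0 e \<alpha>\<close> with \<open>[e0, e \<alpha>]\<close> gives \<open>e \<alpha> e0 = 0\<close> for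
  every \<open>\<alpha>\<close>. Over the complex numbers the generalized eigenspaces fill the whole space, so the
  root vectors span it (\<open>span_eigenvectors_eq_UNIV\<close>).

  If every \<open>c \<alpha> (- \<alpha>)\<close> with \<open>\<alpha> \<noteq> 0\<close> vanished, nothing would multiply into the direction of \<open>e0\<close>,
  and the root vectors of nonzero weight would span a proper nonzero ideal; simplicity therefore
  gives some \<open>\<alpha> \<noteq> 0\<close> with \<open>c \<alpha> (- \<alpha>) \<noteq> 0\<close> (\<open>simple_imp_nonzero_pairing\<close>).

  For this \<open>\<alpha>\<close> in fact \<open>c \<alpha> (- \<alpha>) = c (- \<alpha>) \<alpha>\<close>. Otherwise \<open>[e \<alpha>, e (- \<alpha>)]\<close> is a nonzero multiple
  of \<open>e0\<close>, so that \<open>e \<alpha>\<close>, \<open>e (- \<alpha>)\<close> and \<open>e0\<close> span a copy of \<open>sl\<^sub>2\<close>, which acts through \<open>L\<close> on the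
  finite-dimensional space. There \<open>e0\<close> spans a trivial submodule, since \<open>e \<beta> e0 = 0\<close>, and
  \<open>e (- \<alpha>)\<close> maps \<open>e \<alpha>\<close> into it. Modulo \<open>e0\<close>, then, \<open>e \<alpha>\<close> is a lowest weight vector; but its
  weight is positive if signs are normalized so that \<open>e \<alpha>\<close> raises weights, so applying \<open>e \<alpha>\<close> to
  it repeatedly never reaches zero (\<open>no_weight_raising_string\<close>), which is impossible.
\<close>


section \<open>Eigenvectors of a linear operator\<close>

text \<open>Indexed by numbers, not by vectors, so that a repeated vector counts as a relation.\<close>

lemma nontrivial_relation:
  fixes w :: "nat \<Rightarrow> complex ^ 'n::finite"
  obtains c where "\<exists>i\<le>CARD('n). c i \<noteq> 0" and "(\<Sum>i\<le>CARD('n). c i *s w i) = 0"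
proof (cases "inj_on w {..CARD('n)}")
  case True
  let ?S = "w ` {..CARD('n)}"
  have "card ?S = Suc CARD('n)"
    using True by (simp add: card_image)
  moreover have "card ?S \<le> CARD('n)" if "vec.independent ?S"
    using vec.independent_card_le_dim[OF subset_UNIV that] by (simp add: vec_dim_card card_cart_basis)
  ultimately have "vec.dependent ?S"
    by force
  then obtain u where u: "\<exists>v\<in>?S. u v \<noteq> 0" and z: "(\<Sum>v\<in>?S. u v *s v) = 0"
    using vec.dependent_finite[of ?S] by auto
  show ?thesis
  proof
    show "\<exists>i\<le>CARD('n). (u \<circ> w) i \<noteq> 0"
      using u by auto
    show "(\<Sum>i\<le>CARD('n). (u \<circ> w) i *s w i) = 0"
      using z by (simp add: sum.reindex[OF True] o_def)
  qed
next
  case False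
  then obtain i j where ij: "i \<le> CARD('n)" "j \<le> CARD('n)" "i \<noteq> j" "w i = w j"
    by (auto simp: inj_on_def)
  define c where "c = (\<lambda>k. if k = i then 1 else if k = j then - 1 else 0 :: complex)"
  have "(\<Sum>k\<le>CARD('n). c k *s w k) = (\<Sum>k\<in>{i, j}. c k *s w k)"
    by (rule sum.mono_neutral_right) (use ij in \<open>auto simp: c_def\<close>)
  also have "\<dots> = 0"
    using ij by (simp add: c_def vec.scale_minus_left)
  finally have "(\<Sum>k\<le>CARD('n). c k *s w k) = 0" .
  moreover have "\<exists>k\<le>CARD('n). c k \<noteq> 0"
    using ij(1) by (intro exI[of _ i]) (simp add: c_def)
  ultimately show ?thesis
    using that by blast
qed

text \<open>Applying \<open>T - \<kappa> a\<close> to a relation among eigenvectors removes the term of \<open>a\<close> and rescales the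
  others by nonzero factors.\<close>

lemma eigenvector_sum_eq_0:
  fixes u :: "'i \<Rightarrow> complex ^ 'n::finite"
  assumes T: "Vector_Spaces.linear (*s) (*s) T"
    and "finite A" and "inj_on \<kappa> A"
    and "\<And>i. i \<in> A \<Longrightarrow> T (u i) = \<kappa> i *s u i" and "\<And>i. i \<in> A \<Longrightarrow> u i \<noteq> 0"
    and "(\<Sum>i\<in>A. c i *s u i) = 0"
  shows "\<forall>i\<in>A. c i = 0"
  using assms(2-)
proof (induction A arbitrary: c rule: finite_induct)
  case (insert a A)
  have rel: "c a *s u a + (\<Sum>i\<in>A. c i *s u i) = 0"
    using insert.prems(4) insert.hyps by simp
  have "T (c a *s u a + (\<Sum>i\<in>A. c i *s u i)) = 0"
    using rel vec.linear_0[OF T] by simp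
  then have "(\<Sum>i\<in>A. (\<kappa> i * c i) *s u i) + (\<kappa> a * c a) *s u a = 0"
    using insert.prems(2)
    by (simp add: vec.linear_add[OF T] vec.linear_sum[OF T] vec.linear_scale[OF T]
        vec.scale_scale mult.commute add.commute)
  moreover have "(\<Sum>i\<in>A. (\<kappa> a * c i) *s u i) + (\<kappa> a * c a) *s u a = 0"
    using arg_cong[OF rel, of "\<lambda>v. \<kappa> a *s v"]
    by (simp add: vec.scale_right_distrib vec.scale_sum_right vec.scale_scale add.commute)
  ultimately have "(\<Sum>i\<in>A. (\<kappa> i * c i) *s u i) - (\<Sum>i\<in>A. (\<kappa> a * c i) *s u i) = 0"
    by (simp add: eq_neg_iff_add_eq_0[symmetric])
  then have "(\<Sum>i\<in>A. ((\<kappa> i - \<kappa> a) * c i) *s u i) = 0"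
    by (simp only: left_diff_distrib vec.scale_left_diff_distrib sum_subtractf)
  then have "\<forall>i\<in>A. (\<kappa> i - \<kappa> a) * c i = 0"
    using insert.prems by (intro insert.IH) auto
  then have A: "\<forall>i\<in>A. c i = 0"
    using insert.prems(1) insert.hyps(2) by (auto simp: inj_on_def)
  then have "c a *s u a = 0"
    using rel by simp
  then show ?case
    using A insert.prems(3) by (simp add: vec.scale_eq_0_iff)
qed simp

text \<open>A finite-dimensional space has no room for infinitely many distinct eigenvalues.\<close>

lemma eigenvector_sequence_vanishes:
  fixes u :: "nat \<Rightarrow> complex ^ 'n::finite"
  assumes T: "Vector_Spaces.linear (*s) (*s) T"
    and "inj \<kappa>" and "\<And>k. T (u k) = \<kappa> k *s u k"
  obtains k where "u k = 0"
proof -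
  obtain c where c: "\<exists>i\<le>CARD('n). c i \<noteq> 0" "(\<Sum>i\<le>CARD('n). c i *s u i) = 0"
    by (rule nontrivial_relation)
  have "inj_on \<kappa> {..CARD('n)}"
    using assms(2) by (rule inj_on_subset) simp
  then show ?thesis
    using eigenvector_sum_eq_0[OF T, of "{..CARD('n)}" \<kappa> u c] c assms(3) that by auto
qed

text \<open>This is \<open>p(T) v\<close>, evaluated by Horner's scheme.\<close>

definition poly_apply :: "(complex ^ 'n \<Rightarrow> complex ^ 'n) \<Rightarrow> complex poly \<Rightarrow> complex ^ 'n \<Rightarrow> complex ^ 'n"
  where "poly_apply T p v = fold_coeffs (\<lambda>a w. a *s v + T w) p 0"

context
  fixes T :: "complex ^ 'n::finite \<Rightarrow> complex ^ 'n"
  assumes T: "Vector_Spaces.linear (*s) (*s) T"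
begin

lemma poly_apply_0: "poly_apply T 0 v = 0"
  by (simp add: poly_apply_def)

lemma poly_apply_pCons: "poly_apply T (pCons a p) v = a *s v + T (poly_apply T p v)"
  by (cases "p = 0"; cases "a = 0")
    (simp_all add: poly_apply_def fold_coeffs_pCons_not_0_0_eq vec.linear_0[OF T])

lemma poly_apply_add: "poly_apply T (p + q) v = poly_apply T p v + poly_apply T q v"
  by (induction p q rule: poly_induct2)
    (simp_all add: poly_apply_0 poly_apply_pCons vec.linear_add[OF T] vec.scale_left_distrib)

lemma poly_apply_smult: "poly_apply T (smult a p) v = a *s poly_apply T p v"
  by (induction p)
    (simp_all add: poly_apply_0 poly_apply_pCons vec.linear_scale[OF T] vec.scale_right_distrib
      vec.scale_scale)

lemma poly_apply_linear_factor:
  "poly_apply T ([:- a, 1:] * q) v = T (poly_apply T q v) - a *s poly_apply T q v"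
proof -
  have "[:- a, 1:] * q = pCons 0 q + smult (- a) q"
    by simp
  then show ?thesis
    by (simp only: poly_apply_add poly_apply_smult poly_apply_pCons) (simp add: vec.scale_minus_left)
qed

lemma poly_apply_monom: "poly_apply T (monom a i) v = a *s (T ^^ i) v"
  by (induction i)
    (simp_all add: monom_0 monom_Suc poly_apply_pCons poly_apply_0 vec.linear_0[OF T]
      vec.linear_scale[OF T])

lemma poly_apply_sum: "poly_apply T (\<Sum>i\<in>A. p i) v = (\<Sum>i\<in>A. poly_apply T (p i) v)"
  by (induction A rule: infinite_finite_induct) (simp_all add: poly_apply_0 poly_apply_add)

lemma annihilating_poly:
  obtains p where "p \<noteq> 0" and "poly_apply T p v = 0"
proof -
  obtain c where c: "\<exists>i\<le>CARD('n). c i \<noteq> 0" "(\<Sum>i\<le>CARD('n). c i *s (T ^^ i) v) = 0"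
    by (rule nontrivial_relation[of "\<lambda>i. (T ^^ i) v"])
  let ?p = "\<Sum>i\<le>CARD('n). monom (c i) i"
  have "coeff ?p i = c i" if "i \<le> CARD('n)" for i
    using that by (simp add: coeff_sum)
  then have "?p \<noteq> 0"
    using c(1) by fastforce
  moreover have "poly_apply T ?p v = 0"
    using c(2) by (simp add: poly_apply_sum poly_apply_monom)
  ultimately show ?thesis
    by (rule that)
qed

text \<open>The hypothesis says that no \<open>T - a\<close> has a kernel on the quotient by \<open>S\<close>. Every vector is
  annihilated by some \<open>p(T)\<close>, and \<open>p\<close> splits into linear factors, which can be cancelled modulo
  \<open>S\<close> one at a time.\<close>

lemma subspace_eq_UNIV_if_shift_saturated:
  assumes S: "vec.subspace S" and sat: "\<And>a v. T v - a *s v \<in> S \<Longrightarrow> v \<in> S"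
  shows "S = UNIV"
proof -
  have *: "v \<in> S" if "p \<noteq> 0" "poly_apply T p v \<in> S" for p v
    using that
  proof (induction "degree p" arbitrary: p)
    case 0
    then obtain a where a: "p = [:a:]" "a \<noteq> 0"
      by (metis degree_eq_zeroE pCons_0_0)
    then have "a *s v \<in> S"
      using 0 by (simp add: poly_apply_pCons poly_apply_0 vec.linear_0[OF T])
    from vec.subspace_scale[OF S this, of "inverse a"] show ?case
      using a by (simp add: vec.scale_scale)
  next
    case (Suc n)
    then have "\<not> constant (poly p)"
      by (simp add: constant_degree)
    then obtain a where "poly p a = 0"
      using fundamental_theorem_of_algebra by blast
    then obtain q where q: "p = [:- a, 1:] * q"
      by (metis dvdE poly_eq_0_iff_dvd)
    with Suc.prems have "q \<noteq> 0"
      by auto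
    with q Suc.hyps(2) have "n = degree q"
      by (simp add: degree_mult_eq del: mult_pCons_left)
    moreover have "poly_apply T q v \<in> S"
      using Suc.prems(2) sat unfolding q poly_apply_linear_factor by blast
    ultimately show ?case
      using Suc.hyps(1) \<open>q \<noteq> 0\<close> by blast
  qed
  show ?thesis
    using annihilating_poly * vec.subspace_0[OF S] by (metis UNIV_eq_I)
qed

text \<open>The primary decomposition for one-dimensional generalized eigenspaces. Eigenvalues and
  other numbers are treated alike: \<open>e a = 0\<close> if \<open>a\<close> is not an eigenvalue. If \<open>T v - a v\<close> lies in
  the span, its components of eigenvalue \<open>d \<noteq> a\<close> are in the image of \<open>T - a\<close> on the span; after
  subtracting preimages, what remains of \<open>v\<close> is a generalized eigenvector for \<open>a\<close>.\<close>

lemma span_eigenvectors_eq_UNIV: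
  assumes eig: "\<And>a. T (e a) = a *s e a"
    and gen: "\<And>a k v. ((\<lambda>w. T w - a *s w) ^^ k) v = 0 \<Longrightarrow> v \<in> vec.span {e a}"
  shows "vec.span (range e) = UNIV"
proof (rule subspace_eq_UNIV_if_shift_saturated)
  let ?S = "vec.span (range e)"
  show "vec.subspace ?S"
    by (rule vec.subspace_span)
  fix a v
  have "\<exists>s\<in>?S. \<exists>b. w = T s - a *s s + b *s e a" if "w \<in> ?S" for w
    using that
  proof (induction rule: vec.span_induct_alt)
    case base
    show ?case
      by (rule bexI[of _ 0], rule exI[of _ 0]) (simp_all add: vec.linear_0[OF T] vec.span_zero)
  next
    case (step r x y)
    then obtain s b where s: "s \<in> ?S" "y = T s - a *s s + b *s e a"
      by blast
    from step(1) obtain d where d: "x = e d"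
      by blast
    show ?case
    proof (cases "d = a")
      case True
      then have "r *s x + y = T s - a *s s + (r + b) *s e a"
        using s d by (simp add: vec.scale_left_distrib)
      then show ?thesis
        using s(1) by blast
    next
      case False
      let ?t = "(r / (d - a)) *s e d"
      have "T ?t - a *s ?t = ((d - a) * (r / (d - a))) *s e d"
        by (simp only: vec.linear_scale[OF T] eig vec.scale_scale vec.scale_left_diff_distrib
            left_diff_distrib mult.commute)
      then have t: "T ?t - a *s ?t = r *s x"
        using False d by simp
      have "r *s x + y = T (?t + s) - a *s (?t + s) + b *s e a"
        unfolding t[symmetric] s(2)
        by (simp add: vec.linear_add[OF T] vec.scale_right_distrib)
      moreover have "?t + s \<in> ?S"
        by (intro vec.span_add vec.span_scale vec.span_base s) simp
      ultimately show ?thesis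
        by blast
    qed
  qed
  moreover assume "T v - a *s v \<in> ?S"
  ultimately obtain s b where s: "s \<in> ?S" and eq: "T v - a *s v = T s - a *s s + b *s e a"
    by blast
  have "T (v - s) - a *s (v - s) = b *s e a"
    using eq by (simp add: vec.linear_diff[OF T] vec.scale_right_diff_distrib algebra_simps)
  then have "((\<lambda>w. T w - a *s w) ^^ 2) (v - s) = 0"
    by (simp add: numeral_2_eq_2 vec.linear_scale[OF T] eig vec.scale_scale mult.commute)
  then have "v - s \<in> vec.span {e a}"
    by (rule gen)
  then have "v - s \<in> ?S"
    using vec.span_mono[of "{e a}" "range e"] by auto
  from vec.span_add[OF this s] show "v \<in> ?S"
    by simp
qed

end

lemma scalar_multiple_if_dim_le_1:
  fixes V :: "(complex ^ 'n::finite) set"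
  assumes "vec.dim V \<le> 1" "v \<in> V" "w \<in> V" "v \<noteq> 0"
  obtains b where "w = b *s v"
proof (cases "w \<in> vec.span {v}")
  case True
  then show ?thesis
    using that by (auto simp: vec.span_singleton)
next
  case False
  then have "vec.independent {w, v}"
    using assms(4) by (simp add: vec.independent_insert)
  then have "card {w, v} \<le> vec.dim V"
    using assms by (intro vec.independent_card_le_dim) auto
  moreover have "w \<noteq> v"
    using False vec.span_base[of v "{v}"] by auto
  ultimately show ?thesis
    using assms(1) by simp
qed


section \<open>A string of weight vectors\<close>

lemma bilinear_productD:
  assumes "bilinear_product m"
  shows "Vector_Spaces.linear (*s) (*s) (m x)" "Vector_Spaces.linear (*s) (*s) (\<lambda>x. m x y)"
  using assms by (simp_all add: bilinear_product_def)

text \<open>The \<open>sl\<^sub>2\<close> argument. The vectors \<open>u k = x (x (\<dots> x))\<close>, with \<open>k + 1\<close> factors \<open>x\<close>, have weight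
  \<open>(k + 1) a\<close> under \<open>L(h)\<close>. The start \<open>y x = b h\<close> of the recursion for \<open>y (u (k + 1))\<close> disappears
  because \<open>x h = 0\<close>, and \<open>y\<close> takes \<open>u (k + 1)\<close> back to a nonzero multiple of \<open>u k\<close>. So if \<open>x\<close> is
  nonzero, all \<open>u k\<close> are, and \<open>L(h)\<close> has infinitely many eigenvalues.\<close>

lemma no_weight_raising_string:
  assumes lsa: "left_symmetric_algebra m"
    and xh: "m x h = 0" and hx: "m h x = a *s x" and yx: "m y x = b *s h"
    and xy: "lie_bracket m x y = \<kappa> *s h"
    and "a \<noteq> 0" "\<kappa> \<noteq> 0"
  shows "x = 0"
proof -
  have bil: "bilinear_product m"
    and ls: "\<And>p q z. m p (m q z) - m (m p q) z = m q (m p z) - m (m q p) z"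
    using lsa by (auto simp: left_symmetric_algebra_def)
  note L = bilinear_productD(1)[OF bil] and R = bilinear_productD(2)[OF bil]
  have hxz: "m h (m x z) = m x (m h z) + a *s m x z" for z
    using ls[of h x z] by (simp add: xh hx vec.linear_scale[OF R] vec.linear_0[OF R] algebra_simps)
  have yxz: "m y (m x z) = m x (m y z) - \<kappa> *s m h z" for z
  proof -
    have "m (m x y) z - m (m y x) z = m (\<kappa> *s h) z"
      by (simp add: xy[symmetric] lie_bracket_def vec.linear_diff[OF R])
    then have "m (m x y) z = \<kappa> *s m h z + m (m y x) z"
      by (simp add: vec.linear_scale[OF R] diff_eq_eq)
    then show ?thesis
      using ls[of x y z] by (simp add: algebra_simps)
  qed
  define u where "u k = ((m x) ^^ k) x" for k
  have u_Suc: "u (Suc k) = m x (u k)" for k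
    by (simp add: u_def)
  have hu: "m h (u k) = (of_nat (Suc k) * a) *s u k" for k
  proof (induction k)
    case 0
    show ?case by (simp add: u_def hx)
  next
    case (Suc k)
    have "m h (u (Suc k)) = (of_nat (Suc k) * a) *s u (Suc k) + a *s u (Suc k)"
      by (simp add: u_Suc hxz Suc vec.linear_scale[OF L])
    also have "\<dots> = (of_nat (Suc k) * a + a) *s u (Suc k)"
      by (simp only: vec.scale_left_distrib)
    also have "of_nat (Suc k) * a + a = of_nat (Suc (Suc k)) * a"
      by (simp add: algebra_simps)
    finally show ?case .
  qed
  define d where "d k = - (\<kappa> * a * (\<Sum>i\<le>k. of_nat (Suc i)))" for k
  have d_ne: "d k \<noteq> 0" for k
  proof -
    have "(\<Sum>i\<le>k. of_nat (Suc i) :: complex) = of_nat (\<Sum>i\<le>k. Suc i)"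
      by simp
    also have "\<dots> \<noteq> 0"
      unfolding of_nat_eq_0_iff by (simp add: sum.atMost_shift)
    finally show ?thesis
      using assms by (simp add: d_def)
  qed
  have yu: "m y (u (Suc k)) = d k *s u k" for k
  proof (induction k)
    case 0
    show ?case
      by (simp add: u_def yxz yx xh hx d_def vec.linear_scale[OF L] vec.scale_scale
          vec.scale_minus_left)
  next
    case (Suc k)
    have "m y (u (Suc (Suc k))) = d k *s u (Suc k) - \<kappa> *s ((of_nat (Suc (Suc k)) * a) *s u (Suc k))"
      unfolding u_Suc[of "Suc k"] yxz Suc hu by (simp add: u_Suc vec.linear_scale[OF L])
    also have "\<dots> = d (Suc k) *s u (Suc k)"
      unfolding vec.scale_scale vec.scale_left_diff_distrib[symmetric]
      by (simp add: d_def algebra_simps)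
    finally show ?case .
  qed
  have "inj (\<lambda>k. of_nat (Suc k) * a)"
    using \<open>a \<noteq> 0\<close> by (auto simp: inj_def simp del: of_nat_Suc)
  with L obtain k where "u k = 0"
    using eigenvector_sequence_vanishes hu by blast
  then have "u 0 = 0"
  proof (induction k)
    case (Suc k)
    have "d k *s u k = 0"
      using yu[of k] Suc.prems vec.linear_0[OF L] by simp
    then have "u k = 0"
      using d_ne by (simp add: vec.scale_eq_0_iff)
    then show ?case
      by (rule Suc.IH)
  qed
  then show ?thesis
    by (simp add: u_def)
qed


section \<open>Root spaces for a one-dimensional Cartan subalgebra\<close>

lemma bilinear_lie_bracket:
  assumes "bilinear_product m"
  shows "bilinear_product (lie_bracket m)"
proof -
  note L = bilinear_productD(1)[OF assms] and R = bilinear_productD(2)[OF assms]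
  show ?thesis
    unfolding bilinear_product_def lie_bracket_def
    using vec.linear_compose_sub[OF L R] vec.linear_compose_sub[OF R L] by blast
qed

text \<open>\<open>\<rho> (a h) - l (a h)\<close> is \<open>a\<close> times \<open>\<rho> h - l h\<close>, so a vector killed by a power of the latter is
  killed by the same power of the former.\<close>

lemma root_space_span_singleton:
  assumes bil: "bilinear_product \<rho>" and l: "functional_on (vec.span {h}) l"
  shows "root_space \<rho> (vec.span {h}) l = {v. \<exists>k. ((\<lambda>w. \<rho> h w - l h *s w) ^^ k) v = 0}"
proof -
  note L = bilinear_productD(1)[OF bil] and R = bilinear_productD(2)[OF bil]
  let ?D = "\<lambda>w. \<rho> h w - l h *s w"
  have h: "h \<in> vec.span {h}"
    by (simp add: vec.span_base)
  have pow: "((\<lambda>w. \<rho> (a *s h) w - l (a *s h) *s w) ^^ k) v = a ^ k *s (?D ^^ k) v" for a k v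
  proof (induction k)
    case (Suc k)
    have l_scale: "l (a *s h) = a * l h"
      using l h by (simp add: functional_on_def)
    show ?case
      unfolding funpow.simps o_apply Suc
      by (simp add: l_scale add: Suc vec.linear_scale[OF L] vec.linear_scale[OF R] vec.scale_scale
          vec.scale_right_diff_distrib mult.commute mult.left_commute)
  qed simp
  show ?thesis
  proof (rule Set.set_eqI, rule iffI)
    fix v assume "v \<in> root_space \<rho> (vec.span {h}) l"
    with h show "v \<in> {v. \<exists>k. (?D ^^ k) v = 0}"
      by (auto simp: root_space_def)
  next
    fix v assume "v \<in> {v. \<exists>k. (?D ^^ k) v = 0}"
    then obtain k where "(?D ^^ k) v = 0"
      by blast
    then have "\<exists>k. ((\<lambda>w. \<rho> x w - l x *s w) ^^ k) v = 0" if "x \<in> vec.span {h}" for x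
    proof -
      from that obtain a where "x = a *s h"
        by (auto simp: vec.span_singleton)
      then show ?thesis
        using pow[where k = k and v = v] \<open>(?D ^^ k) v = 0\<close> by auto
    qed
    then show "v \<in> root_space \<rho> (vec.span {h}) l"
      by (simp add: root_space_def)
  qed
qed

text \<open>The nilpotent operator \<open>\<rho> h - l h\<close> preserves the root space, and a nilpotent operator on a line
  is zero. Applied below to \<open>ad\<close>.\<close>

lemma root_vector_is_eigenvector:
  assumes bil: "bilinear_product \<rho>" and l: "functional_on (vec.span {h}) l"
    and dim: "vec.dim (root_space \<rho> (vec.span {h}) l) \<le> 1"
    and v: "v \<in> root_space \<rho> (vec.span {h}) l"
  shows "\<rho> h v = l h *s v"
proof (cases "v = 0")
  case True
  then show ?thesis
    by (simp add: vec.linear_0[OF bilinear_productD(1)[OF bil]])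
next
  case False
  note L = bilinear_productD(1)[OF bil]
  let ?D = "\<lambda>w. \<rho> h w - l h *s w"
  have D_scale: "?D (b *s w) = b *s ?D w" for b w
    by (simp add: vec.linear_scale[OF L] vec.scale_right_diff_distrib vec.scale_scale mult.commute)
  note rs = root_space_span_singleton[OF bil l]
  obtain k where k: "(?D ^^ k) v = 0"
    using v by (auto simp: rs)
  have "(?D ^^ k) (?D v) = ?D ((?D ^^ k) v)"
    by (rule funpow_swap1[symmetric])
  also have "\<dots> = 0"
    using k by (simp add: vec.linear_0[OF L])
  finally have "?D v \<in> root_space \<rho> (vec.span {h}) l"
    by (auto simp: rs)
  then obtain b where b: "?D v = b *s v"
    by (rule scalar_multiple_if_dim_le_1[OF dim v _ False])
  have "(?D ^^ j) v = b ^ j *s v" for j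
  proof (induction j)
    case (Suc j)
    then have "(?D ^^ Suc j) v = ?D (b ^ j *s v)"
      by simp
    also have "\<dots> = b ^ j *s (b *s v)"
      unfolding D_scale b ..
    finally show ?case
      by (simp add: vec.scale_scale mult.commute)
  qed simp
  with k have "b ^ k *s v = 0"
    by simp
  with False have "b = 0"
    by (auto simp: vec.scale_eq_0_iff)
  with b show ?thesis
    by simp
qed

text \<open>Nilpotency of \<open>H\<close>: the \<open>j\<close>-th power of \<open>ad(x)\<close> maps \<open>H\<close> into the \<open>j\<close>-th term of its lower
  central series.\<close>

lemma cartan_subalgebra_subset_root_space_0:
  assumes "cartan_subalgebra b H"
  shows "H \<subseteq> root_space b H (\<lambda>_. 0)"
proof
  fix y assume y: "y \<in> H"
  obtain k where k: "lower_central b H k = {0}"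
    using assms by (auto simp: cartan_subalgebra_def)
  have "((\<lambda>w. b x w - 0 *s w) ^^ j) y \<in> lower_central b H j" if "x \<in> H" for x j
  proof (induction j)
    case (Suc j)
    then have "b x (((\<lambda>w. b x w - 0 *s w) ^^ j) y) \<in> lower_central b H (Suc j)"
      unfolding lower_central.simps using that by (intro vec.span_base) blast
    then show ?case
      by simp
  qed (simp add: y)
  then show "y \<in> root_space b H (\<lambda>_. 0)"
    using k by (force simp: root_space_def)
qed

text \<open>\<open>H\<close> lies in a root space of dimension at most one. It is not zero, because the zero
  subalgebra is normalized by everything and a Cartan subalgebra is its own normalizer.\<close>

lemma canonical_cartan_eq_span:
  assumes bil: "bilinear_product m" and can: "canonical_cartan m H"
    and dim: "vec.dim (root_space m H (\<lambda>_. 0)) \<le> 1"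
    and h: "h \<in> root_space m H (\<lambda>_. 0)" "h \<noteq> 0"
  shows "H = vec.span {h}"
proof -
  have cartan: "cartan_subalgebra (lie_bracket m) H"
    and "root_space m H (\<lambda>_. 0) = root_space (lie_bracket m) H (\<lambda>_. 0)"
    using can by (simp_all add: canonical_cartan_def functional_on_def)
  then have sub: "H \<subseteq> root_space m H (\<lambda>_. 0)"
    using cartan_subalgebra_subset_root_space_0 by metis
  have subspace: "vec.subspace H"
    using cartan by (simp add: cartan_subalgebra_def lie_subalgebra_def)
  have "H \<noteq> {0}"
  proof
    assume "H = {0}"
    then have "{x. \<forall>y\<in>H. lie_bracket m x y \<in> H} = UNIV"
      using vec.linear_0[OF bilinear_productD(1)[OF bilinear_lie_bracket[OF bil]]] by auto
    with cartan \<open>H = {0}\<close> h(2) show False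
      by (auto simp: cartan_subalgebra_def)
  qed
  then obtain x where x: "x \<in> H" "x \<noteq> 0"
    using vec.subspace_0[OF subspace] by blast
  then obtain a where "h = a *s x"
    using scalar_multiple_if_dim_le_1[OF dim _ h(1)] sub by blast
  then have "h \<in> H"
    using vec.subspace_scale[OF subspace x(1)] by simp
  then have "vec.span {h} \<subseteq> H"
    using subspace by (intro vec.span_minimal) auto
  moreover have "y \<in> vec.span {h}" if "y \<in> H" for y
    using scalar_multiple_if_dim_le_1[OF dim h(1) _ h(2)] that sub
    by (metis in_mono rangeI vec.span_singleton)
  ultimately show ?thesis
    by blast
qed

text \<open>Spectral statements about \<open>L(e0)\<close> at a number \<open>\<alpha>\<close> are thereby statements about root spaces.\<close>

lemma obtain_functional:
  fixes h :: "complex ^ 'n::finite"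
  assumes "h \<noteq> 0"
  obtains l where "functional_on H l" "l h = \<alpha>"
proof -
  obtain i where "h $ i \<noteq> 0"
    using assms by (auto simp: vec_eq_iff)
  then show ?thesis
    by (intro that[of "\<lambda>x. x $ i / h $ i * \<alpha>"])
      (auto simp: functional_on_def field_simps)
qed


section \<open>Simplicity\<close>

lemma bilinear_span_closed:
  assumes bil: "bilinear_product m" and J: "vec.subspace J"
    and gen: "\<And>a b. a \<in> A \<Longrightarrow> b \<in> B \<Longrightarrow> m a b \<in> J"
    and x: "x \<in> vec.span A" and y: "y \<in> vec.span B"
  shows "m x y \<in> J"
proof -
  note L = bilinear_productD(1)[OF bil] and R = bilinear_productD(2)[OF bil]
  note J_closed = vec.subspace_0[OF J] vec.subspace_add[OF J] vec.subspace_scale[OF J]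
  have gen_y: "m a y \<in> J" if "a \<in> A" for a
    using y
    by (induction rule: vec.span_induct_alt)
      (simp_all add: J_closed gen that vec.linear_0[OF L] vec.linear_add[OF L] vec.linear_scale[OF L])
  from x show ?thesis
    by (induction rule: vec.span_induct_alt)
      (simp_all add: J_closed gen_y vec.linear_0[OF R] vec.linear_add[OF R] vec.linear_scale[OF R])
qed

text \<open>Without such an \<open>\<alpha>\<close> the span \<open>J\<close> of the vectors \<open>e \<alpha>\<close> with \<open>\<alpha> \<noteq> 0\<close> is an ideal. It is not
  zero, since \<open>e 0\<close> alone spans an algebra with zero product. It is not everything, since left
  multiplication by \<open>e 0\<close> maps \<open>J\<close> onto itself but kills \<open>e 0\<close>.\<close>

lemma simple_imp_nonzero_pairing:
  assumes bil: "bilinear_product m" and simple: "simple_algebra m"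
    and eig: "\<And>\<alpha>. m (e 0) (e \<alpha>) = \<alpha> *s e \<alpha>"
    and prod: "\<And>\<alpha> \<beta>. m (e \<alpha>) (e \<beta>) = c \<alpha> \<beta> *s e (\<alpha> + \<beta>)"
    and spans: "vec.span (range e) = UNIV" and "e 0 \<noteq> 0"
  obtains \<alpha> where "\<alpha> \<noteq> 0" "c \<alpha> (- \<alpha>) \<noteq> 0"
proof -
  note L = bilinear_productD(1)[OF bil] and R = bilinear_productD(2)[OF bil]
  define J where "J = vec.span (e ` (- {0}))"
  have J: "vec.subspace J"
    by (simp add: J_def)
  have e_J: "e \<gamma> \<in> J" if "\<gamma> \<noteq> 0" for \<gamma>
    using that by (auto simp: J_def intro: vec.span_base)
  have False if no: "\<And>\<alpha>. \<alpha> \<noteq> 0 \<Longrightarrow> c \<alpha> (- \<alpha>) = 0"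
  proof -
    have prod_J: "m (e \<alpha>) (e \<beta>) \<in> J" if "\<alpha> \<noteq> 0 \<or> \<beta> \<noteq> 0" for \<alpha> \<beta>
    proof (cases "\<alpha> + \<beta> = 0")
      case True
      then have "\<beta> = - \<alpha>" "\<alpha> \<noteq> 0"
        using that by (auto simp: add_eq_0_iff)
      then show ?thesis
        using no vec.subspace_0[OF J] by (simp add: prod)
    next
      case False
      then show ?thesis
        using e_J vec.subspace_scale[OF J] by (simp add: prod)
    qed
    have "two_sided_ideal m J"
      unfolding two_sided_ideal_def
    proof (intro conjI ballI allI J)
      fix x y assume x: "x \<in> J"
      show "m x y \<in> J"
        by (rule bilinear_span_closed[OF bil J, of "e ` (- {0})" "range e"])
          (use x spans prod_J in \<open>auto simp: J_def[symmetric]\<close>)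
      show "m y x \<in> J"
        by (rule bilinear_span_closed[OF bil J, of "range e" "e ` (- {0})"])
          (use x spans prod_J in \<open>auto simp: J_def[symmetric]\<close>)
    qed
    with simple consider "J = {0}" | "J = UNIV"
      by (auto simp: simple_algebra_def)
    then show False
    proof cases
      case 1
      have prod_0: "m (e \<alpha>) (e \<beta>) \<in> {0}" for \<alpha> \<beta>
      proof (cases "\<alpha> \<noteq> 0 \<or> \<beta> \<noteq> 0")
        case True
        then show ?thesis
          using prod_J 1 by blast
      next
        case False
        then show ?thesis
          using eig[of 0] by simp
      qed
      have "m x y \<in> {0}" for x y
        by (rule bilinear_span_closed[OF bil vec.subspace_single_0, of "range e" "range e"])
          (use prod_0 spans in blast)+
      then have "\<nexists>x y. m x y \<noteq> 0"
        by blast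
      with simple show False
        unfolding simple_algebra_def by blast
    next
      case 2
      have "e \<alpha> \<in> range (m (e 0))" if "\<alpha> \<noteq> 0" for \<alpha>
      proof
        show "e \<alpha> = m (e 0) (inverse \<alpha> *s e \<alpha>)"
          using that by (simp add: vec.linear_scale[OF L] eig vec.scale_scale)
      qed simp
      then have "J \<subseteq> range (m (e 0))"
        unfolding J_def
        by (intro vec.span_minimal vec.linear_subspace_image[OF L] vec.subspace_UNIV) auto
      with 2 have "surj (m (e 0))"
        by auto
      then have "inj (m (e 0))"
        using vec.linear_surj_imp_inj[OF L] by blast
      moreover have "m (e 0) (e 0) = m (e 0) 0"
        using eig[of 0] by (simp add: vec.linear_0[OF L])
      ultimately show False
        using \<open>e 0 \<noteq> 0\<close> by (auto dest: injD)
    qed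
  qed
  then show ?thesis
    using that by blast
qed


section \<open>Symmetric pairs of edges into zero\<close>

theorem mainTheorem11:
  fixes m :: "'n::finite product"
    and H :: "(complex ^ 'n) set"
    and e0 :: "complex ^ 'n"
    and e :: "complex \<Rightarrow> complex ^ 'n"
    and c :: "complex \<Rightarrow> complex \<Rightarrow> complex"
    and \<Lambda> :: "complex set"
  assumes "left_symmetric_algebra m"
    and "complete_lsa m"
    and "simple_algebra m"
    and "canonical_cartan m H"
    and "\<And>l. functional_on H l \<Longrightarrow> vec.dim (root_space m H l) \<le> 1"
    and "e0 \<in> root_space m H (\<lambda>_. 0)" and "e0 \<noteq> 0"
    and "\<Lambda> = root_numbers m H e0"
    and "root_base m H e0 e"
    and "structure_constants m \<Lambda> e c"
  shows "\<exists>\<alpha>. \<alpha> \<noteq> 0 \<and> \<alpha> \<in> \<Lambda> \<and> - \<alpha> \<in> \<Lambda> \<and>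
           (\<alpha>, 0) \<in> parcs (Gamma_l \<Lambda> c) \<and> (- \<alpha>, 0) \<in> parcs (Gamma_l \<Lambda> c) \<and>
           (\<alpha>, 0) \<in> parcs (Gamma_r \<Lambda> c) \<and> (- \<alpha>, 0) \<in> parcs (Gamma_r \<Lambda> c)"
proof -
  have bil: "bilinear_product m"
    using assms(1) by (simp add: left_symmetric_algebra_def)
  note L = bilinear_productD(1)[OF bil] and R = bilinear_productD(2)[OF bil]
  have "functional_on H (\<lambda>_. 0)"
    by (simp add: functional_on_def)
  then have H: "H = vec.span {e0}"
    using assms(5-7) by (intro canonical_cartan_eq_span[OF bil assms(4)]) auto
  have root_eq: "root_space (lie_bracket m) H l = root_space m H l" if "functional_on H l" for l
    using assms(4) that by (simp add: canonical_cartan_def)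
  have e_0: "e 0 = e0"
    and e_root: "\<And>l. functional_on H l \<Longrightarrow> root_space m H l \<noteq> {0} \<Longrightarrow>
        e (l e0) \<in> root_space m H l \<and> e (l e0) \<noteq> 0 \<and> m e0 (e (l e0)) = l e0 *s e (l e0)"
    and e_out: "\<And>\<alpha>. \<alpha> \<notin> \<Lambda> \<Longrightarrow> e \<alpha> = 0"
    using assms(8,9) by (auto simp: root_base_def)
  have weight: "\<exists>l. functional_on H l \<and> l e0 = \<alpha> \<and> e \<alpha> \<in> root_space m H l \<and> e \<alpha> \<noteq> 0 \<and>
      m e0 (e \<alpha>) = \<alpha> *s e \<alpha>" if in_spectrum: "\<alpha> \<in> \<Lambda>" for \<alpha>
  proof -
    obtain l where "functional_on H l" "root_space m H l \<noteq> {0}" "\<alpha> = l e0"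
      using in_spectrum assms(8) unfolding root_numbers_def by blast
    with e_root show ?thesis
      by blast
  qed
  have eig: "m e0 (e \<alpha>) = \<alpha> *s e \<alpha>" for \<alpha>
    using weight e_out by (cases "\<alpha> \<in> \<Lambda>") (auto simp: vec.linear_0[OF L])
  have right_0: "m (e \<alpha>) e0 = 0" for \<alpha>
  proof (cases "\<alpha> \<in> \<Lambda>")
    case True
    then obtain l where l: "functional_on H l" "l e0 = \<alpha>" "e \<alpha> \<in> root_space m H l"
      using weight by blast
    \<comment> \<open>The defining property of the canonical subalgebra: the same root space serves \<open>ad\<close>.\<close>
    have "lie_bracket m e0 (e \<alpha>) = l e0 *s e \<alpha>"
      using l(1) assms(5)[OF l(1)] l(3)
      unfolding root_eq[OF l(1), symmetric] unfolding H
      by (rule root_vector_is_eigenvector[OF bilinear_lie_bracket[OF bil]])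
    then show ?thesis
      using l(2) eig[of \<alpha>] by (simp add: lie_bracket_def)
  next
    case False
    then show ?thesis
      using e_out by (simp add: vec.linear_0[OF R])
  qed
  have "v \<in> vec.span {e \<alpha>}" if v: "((\<lambda>w. m e0 w - \<alpha> *s w) ^^ k) v = 0" for \<alpha> k v
  proof -
    obtain l where l: "functional_on H l" "l e0 = \<alpha>"
      using obtain_functional[OF assms(7)] by metis
    have v: "v \<in> root_space m H l"
      using v l unfolding H by (subst root_space_span_singleton[OF bil]) auto
    show ?thesis
    proof (cases "v = 0")
      case False
      with v have "root_space m H l \<noteq> {0}"
        by blast
      from e_root[OF l(1) this] obtain b where "v = b *s e \<alpha>"
        using scalar_multiple_if_dim_le_1[OF assms(5)[OF l(1)] _ v] l(2) by metis
      then show ?thesis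
        by (auto simp: vec.span_singleton)
    qed (simp add: vec.span_zero)
  qed
  then have spans: "vec.span (range e) = UNIV"
    by (intro span_eigenvectors_eq_UNIV[OF L[of e0] eig])
  have prod: "m (e \<alpha>) (e \<beta>) = c \<alpha> \<beta> *s e (\<alpha> + \<beta>)" for \<alpha> \<beta>
    using assms(10) e_out
    by (cases "\<alpha> \<in> \<Lambda>"; cases "\<beta> \<in> \<Lambda>")
      (auto simp: structure_constants_def vec.linear_0[OF L] vec.linear_0[OF R])
  obtain \<alpha> where \<alpha>: "\<alpha> \<noteq> 0" "c \<alpha> (- \<alpha>) \<noteq> 0"
    using simple_imp_nonzero_pairing[OF bil assms(3) _ prod spans] eig assms(7) e_0 by metis
  have in_\<Lambda>: "\<alpha> \<in> \<Lambda>" "- \<alpha> \<in> \<Lambda>" "0 \<in> \<Lambda>"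
    using \<alpha>(2) assms(7,10) e_out[of 0] e_0 by (auto simp: structure_constants_def)
  have "c \<alpha> (- \<alpha>) = c (- \<alpha>) \<alpha>"
  proof (rule ccontr)
    assume "c \<alpha> (- \<alpha>) \<noteq> c (- \<alpha>) \<alpha>"
    then have ne: "c \<alpha> (- \<alpha>) - c (- \<alpha>) \<alpha> \<noteq> 0"
      by simp
    have xy: "lie_bracket m (e \<alpha>) (e (- \<alpha>)) = (c \<alpha> (- \<alpha>) - c (- \<alpha>) \<alpha>) *s e0"
      by (simp add: lie_bracket_def prod e_0 vec.scale_left_diff_distrib)
    have yx: "m (e (- \<alpha>)) (e \<alpha>) = c (- \<alpha>) \<alpha> *s e0"
      by (simp add: prod e_0)
    have "e \<alpha> = 0"
      by (rule no_weight_raising_string[OF assms(1) right_0 eig yx xy \<alpha>(1) ne])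
    with weight[OF in_\<Lambda>(1)] show False
      by blast
  qed
  with \<alpha> in_\<Lambda> show ?thesis
    by (intro exI[of _ \<alpha>]) (simp add: Gamma_l_def Gamma_r_def)
qed

end
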